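(* Let $G$ be a graph of order $n$ and size $m$ (number of edges), and let $\gamma_{\rm esp}=\gamma_{\rm esp}(G)$ be its end super domination number. Then $$m\le \binom{n}{2}-(n-\gamma_{\rm esp})(n-\gamma_{\rm esp}-1).$$ Moreover, equality holds if and only if $G$ is obtained from a complete graph $K_n$ by removing all edges of a complete bipartite subgraph $K_{n-\gamma_{\rm esp},\,n-\gamma_{\rm esp}}$ of $K_n$, except for the edges of a perfect matching between the partite sets of this bipartite subgraph.
   Context: Graphs are finite, simple and undirected. For a graph $G=(V,E)$ and $S\subseteq V$, write $\overline{S}=V\setminus S$, and let $N(v)$ be the open neighbourhood of $v$. A set $S \subseteq V$ is an end super dominating set (ESD-set) of $G$ if for every $u\in\overline{S}$ there exists $v\in S$ with $N(v)\cap\overline{S}=\{u\}$, and moreover $\deg(u)\ge 2$ for every $u\in\overline{S}$. The end super domination number $\gamma_{\rm esp}(G)$ is the minimum cardinality of an ESD-set of $G$. Here $K_{a,a}$ denotes the complete bipartite graph with both partite sets of cardinality $a$ (for $a=0$ it is empty and no edges are removed). *)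

theory Defs imports Complex_Main begin

definition simple_graph :: "'a set \<Rightarrow> 'a set set \<Rightarrow> bool" where
  "simple_graph V E \<longleftrightarrow> finite V \<and> (\<forall>e\<in>E. e \<subseteq> V \<and> card e = 2)"

definition nbhd :: "'a set set \<Rightarrow> 'a \<Rightarrow> 'a set" where
  "nbhd E v = {u. {u, v} \<in> E}"

definition degree :: "'a set set \<Rightarrow> 'a \<Rightarrow> nat" where
  "degree E v = card (nbhd E v)"

definition esd_set :: "'a set \<Rightarrow> 'a set set \<Rightarrow> 'a set \<Rightarrow> bool" where
  "esd_set V E S \<longleftrightarrow> S \<subseteq> V \<and>
     (\<forall>u\<in>V - S. \<exists>v\<in>S. nbhd E v \<inter> (V - S) = {u}) \<and>
     (\<forall>u\<in>V - S. degree E u \<ge> 2)"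

definition esd_number :: "'a set \<Rightarrow> 'a set set \<Rightarrow> nat" where
  "esd_number V E = Min (card ` {S. esd_set V E S})"

(* The set over which Min is taken is finite and nonempty, so the minimum is attained. *)
lemma esd_set_vertices: "esd_set V E V"
  by (simp add: esd_set_def)

lemma finite_esd_sets: "finite V \<Longrightarrow> finite {S. esd_set V E S}"
  by (rule finite_subset[of _ "Pow V"]) (auto simp: esd_set_def)

lemma esd_number_attained:
  assumes "finite V"
  obtains S where "esd_set V E S" "card S = esd_number V E"
proof -
  have "card ` {S. esd_set V E S} \<noteq> {}" using esd_set_vertices[of V E] by blast
  then have "esd_number V E \<in> card ` {S. esd_set V E S}"
    unfolding esd_number_def using assms by (intro Min_in) (simp_all add: finite_esd_sets)
  then show thesis using that by auto
qed

lemma esd_number_le: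
  assumes "finite V" "esd_set V E S"
  shows "esd_number V E \<le> card S"
  unfolding esd_number_def using assms by (intro Min_le) (simp_all add: finite_esd_sets)

lemma esd_number_le_order: "finite V \<Longrightarrow> esd_number V E \<le> card V"
  by (simp add: esd_number_le esd_set_vertices)

definition complete_edges :: "'a set \<Rightarrow> 'a set set" where
  "complete_edges V = {e. e \<subseteq> V \<and> card e = 2}"

definition complete_bipartite_edges :: "'a set \<Rightarrow> 'a set \<Rightarrow> 'a set set" where
  "complete_bipartite_edges A B = {{a, b} | a b. a \<in> A \<and> b \<in> B}"

definition perfect_matching :: "'a set \<Rightarrow> 'a set set \<Rightarrow> 'a set set \<Rightarrow> bool" where
  "perfect_matching V E M \<longleftrightarrow> M \<subseteq> E \<and> (\<forall>v\<in>V. \<exists>!e. e \<in> M \<and> v \<in> e)"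

(* K_n is taken on V itself: all its edges except those of a subgraph K_{k,k} with partite sets A and B,
   keeping a perfect matching M of that subgraph. *)
definition complete_minus_bipartite :: "'a set \<Rightarrow> 'a set set \<Rightarrow> nat \<Rightarrow> bool" where
  "complete_minus_bipartite V E k \<longleftrightarrow>
     (\<exists>A B M. A \<subseteq> V \<and> B \<subseteq> V \<and> A \<inter> B = {} \<and> card A = k \<and> card B = k \<and>
        perfect_matching (A \<union> B) (complete_bipartite_edges A B) M \<and>
        E = complete_edges V - (complete_bipartite_edges A B - M))"

end

theory Submission imports Defs begin

text \<open>
  Let \<open>S\<close> be a minimum ESD-set and \<open>A = V - S\<close>, so \<open>A\<close> has \<open>k = n - \<gamma>\<close> elements. Each \<open>u \<in> A\<close> has
  a private vertex \<open>f u \<in> S\<close>, whose only neighbour in \<open>A\<close> is \<open>u\<close>. Then \<open>f\<close> is injective and no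
  edge joins \<open>f u\<close> to another vertex of \<open>A\<close>. So \<open>G\<close> is a subgraph of the complete graph without the
  edges of the \<open>K\<^bsub>k,k\<^esub>\<close> between \<open>A\<close> and \<open>f ` A\<close>, except for the matching \<open>u \<mapsto> f u\<close>. That graph
  has exactly as many edges as the bound allows.
\<close>

lemma card_complete_edges: "finite V \<Longrightarrow> card (complete_edges V) = card V choose 2"
  by (simp add: complete_edges_def n_subsets)

lemma finite_complete_edges: "finite V \<Longrightarrow> finite (complete_edges V)"
  by (rule finite_subset[of _ "Pow V"]) (auto simp: complete_edges_def)

lemma complete_bipartite_edges_subset:
  assumes "A \<subseteq> V" "B \<subseteq> V" "A \<inter> B = {}"
  shows "complete_bipartite_edges A B \<subseteq> complete_edges V"
proof
  fix e
  assume "e \<in> complete_bipartite_edges A B"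
  then obtain a b where ab: "e = {a, b}" "a \<in> A" "b \<in> B"
    by (auto simp: complete_bipartite_edges_def)
  then have "a \<noteq> b" using assms by blast
  then show "e \<in> complete_edges V" using ab assms by (auto simp: complete_edges_def)
qed

text \<open>Since no vertex is on both sides, an edge determines which endpoint lies in
  \<open>A\<close> and which in \<open>B\<close>, so edges correspond to pairs in
  \<open>A \<times> B\<close>.\<close>

lemma card_complete_bipartite_edges:
  assumes "A \<inter> B = {}"
  shows "card (complete_bipartite_edges A B) = card A * card B"
proof -
  have "complete_bipartite_edges A B = (\<lambda>(a, b). {a, b}) ` (A \<times> B)"
    by (auto simp: complete_bipartite_edges_def)
  moreover have "inj_on (\<lambda>(a, b). {a, b}) (A \<times> B)"
    using assms by (auto simp: inj_on_def doubleton_eq_iff)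
  ultimately show ?thesis
    by (simp add: card_image card_cartesian_product)
qed

text \<open>Sending each vertex of \<open>A\<close> to the edge of \<open>M\<close> through it is a
  bijection onto \<open>M\<close>, because every edge has exactly one endpoint in
  \<open>A\<close>.\<close>

lemma card_perfect_matching:
  assumes "A \<inter> B = {}" and M: "perfect_matching (A \<union> B) (complete_bipartite_edges A B) M"
  shows "card M = card A"
proof -
  have "\<forall>a\<in>A. \<exists>e. e \<in> M \<and> a \<in> e"
    using M unfolding perfect_matching_def by blast
  then obtain g where g: "\<And>a. a \<in> A \<Longrightarrow> g a \<in> M" "\<And>a. a \<in> A \<Longrightarrow> a \<in> g a"
    by metis
  have unique: "e = g a" if "a \<in> A" "e \<in> M" "a \<in> e" for a e
    using M that g[OF that(1)] unfolding perfect_matching_def by blast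
  have edge: "\<exists>a\<in>A. \<exists>b\<in>B. e = {a, b}" if "e \<in> M" for e
    using M that unfolding perfect_matching_def complete_bipartite_edges_def by blast
  have "inj_on g A"
  proof (rule inj_onI)
    fix x y
    assume xy: "x \<in> A" "y \<in> A" "g x = g y"
    \<comment> \<open>The common edge contains \<open>x\<close>, \<open>y\<close> and a vertex
      \<open>b\<close> outside \<open>A\<close>. With only two endpoints in all, \<open>x\<close>
      and \<open>y\<close> coincide.\<close>
    obtain a b where "b \<in> B" "g x = {a, b}" using edge g(1)[OF xy(1)] by blast
    moreover have "x \<in> g x" "y \<in> g x" using g(2) xy by auto
    ultimately show "x = y" using xy assms(1) by auto
  qed
  moreover have "M \<subseteq> g ` A"
  proof
    fix e
    assume e: "e \<in> M"
    obtain a b where ab: "a \<in> A" "e = {a, b}" using edge[OF e] by blast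
    then have "e = g a" using unique[OF ab(1) e] by simp
    then show "e \<in> g ` A" using ab(1) by simp
  qed
  then have "g ` A = M" using g(1) by auto
  ultimately show ?thesis by (metis card_image)
qed

text \<open>Of the \<open>k * k\<close> bipartite edges the \<open>k\<close> matching edges stay, so
  \<open>k * (k - 1)\<close> edges are lost. Counting in the integers keeps the subtractions
  exact.\<close>

lemma card_complete_minus_bipartite:
  assumes "finite V" and AB: "A \<subseteq> V" "B \<subseteq> V" "A \<inter> B = {}" "card A = k" "card B = k"
    and M: "perfect_matching (A \<union> B) (complete_bipartite_edges A B) M"
  shows "int (card (complete_edges V - (complete_bipartite_edges A B - M)))
    = int (card V choose 2) - int k * (int k - 1)"
proof -
  let ?K = "complete_bipartite_edges A B"
  have sub: "?K \<subseteq> complete_edges V" using AB by (intro complete_bipartite_edges_subset)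
  have MK: "M \<subseteq> ?K" using M by (simp add: perfect_matching_def)
  have finC: "finite (complete_edges V)" using assms(1) by (rule finite_complete_edges)
  have finK: "finite ?K" using sub finC by (rule finite_subset)
  have "int (card (?K - M)) = int (card ?K) - int (card M)"
    using MK finK by (simp add: card_Diff_subset finite_subset of_nat_diff card_mono)
  also have "\<dots> = int k * (int k - 1)"
    using card_complete_bipartite_edges[OF AB(3)] card_perfect_matching[OF AB(3) M] AB
    by (simp add: algebra_simps)
  finally have D: "int (card (?K - M)) = int k * (int k - 1)" .
  have DC: "?K - M \<subseteq> complete_edges V" using sub by blast
  have "int (card (complete_edges V - (?K - M))) = int (card (complete_edges V)) - int (card (?K - M))"
    using DC finK finC by (simp add: card_Diff_subset of_nat_diff card_mono)
  then show ?thesis using D card_complete_edges[OF assms(1)] by simp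
qed

lemma perfect_matching_graph_of_inj:
  assumes "inj_on f A" "A \<inter> f ` A = {}"
  shows "perfect_matching (A \<union> f ` A) (complete_bipartite_edges A (f ` A)) ((\<lambda>u. {u, f u}) ` A)"
proof -
  have "\<exists>!e. e \<in> (\<lambda>u. {u, f u}) ` A \<and> v \<in> e" if v: "v \<in> A \<union> f ` A" for v
  proof -
    obtain u where u: "u \<in> A" "v \<in> {u, f u}" using v by blast
    \<comment> \<open>Disjointness rules out that \<open>v\<close> is the first end of one pair and
      the second end of another; injectivity of \<open>f\<close> settles two second ends.\<close>
    have "w = u" if "w \<in> A" "v \<in> {w, f w}" for w
      using u that assms by (auto simp: inj_on_def)
    then have "e = {u, f u}" if "e \<in> (\<lambda>u. {u, f u}) ` A \<and> v \<in> e" for e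
      using that by auto
    moreover have "{u, f u} \<in> (\<lambda>u. {u, f u}) ` A \<and> v \<in> {u, f u}"
      using u by simp
    ultimately show ?thesis by (intro ex1I)
  qed
  moreover have "(\<lambda>u. {u, f u}) ` A \<subseteq> complete_bipartite_edges A (f ` A)"
    by (auto simp: complete_bipartite_edges_def)
  ultimately show ?thesis
    unfolding perfect_matching_def by simp
qed

lemma esd_set_imp_subset_complete_minus_bipartite:
  assumes G: "simple_graph V E" and S: "esd_set V E S"
  obtains B M where "B \<subseteq> V" "(V - S) \<inter> B = {}" "card B = card (V - S)"
    "perfect_matching (V - S \<union> B) (complete_bipartite_edges (V - S) B) M"
    "E \<subseteq> complete_edges V - (complete_bipartite_edges (V - S) B - M)"
proof -
  let ?A = "V - S"
  have "\<forall>u\<in>?A. \<exists>v. v \<in> S \<and> nbhd E v \<inter> ?A = {u}"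
    using S unfolding esd_set_def by blast
  then obtain f where f: "\<And>u. u \<in> ?A \<Longrightarrow> f u \<in> S" "\<And>u. u \<in> ?A \<Longrightarrow> nbhd E (f u) \<inter> ?A = {u}"
    by metis
  \<comment> \<open>If \<open>f x = f y\<close>, then \<open>{x}\<close> and \<open>{y}\<close> are
    the same trace of a neighbourhood on \<open>?A\<close>.\<close>
  have inj: "inj_on f ?A"
    by (rule inj_onI) (metis f(2) singleton_inject)
  have disj: "?A \<inter> f ` ?A = {}" using f(1) by blast
  have BV: "f ` ?A \<subseteq> V" using f(1) S unfolding esd_set_def by blast
  let ?M = "(\<lambda>u. {u, f u}) ` ?A"
  have "e \<notin> complete_bipartite_edges ?A (f ` ?A) - ?M" if "e \<in> E" for e
  proof
    assume "e \<in> complete_bipartite_edges ?A (f ` ?A) - ?M"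
    then obtain u w where uw: "u \<in> ?A" "w \<in> ?A" "e = {u, f w}" "e \<notin> ?M"
      unfolding complete_bipartite_edges_def by blast
    \<comment> \<open>That trace is \<open>{w}\<close>, so an edge of the graph between
      \<open>?A\<close> and its private vertices can only be a matching edge.\<close>
    then have "u \<in> nbhd E (f w) \<inter> ?A" using that by (simp add: nbhd_def)
    then have "u = w" using f(2)[OF uw(2)] by blast
    then show False using uw by blast
  qed
  then have "E \<subseteq> complete_edges V - (complete_bipartite_edges ?A (f ` ?A) - ?M)"
    using G unfolding simple_graph_def complete_edges_def by blast
  with that[OF BV disj card_image[OF inj] perfect_matching_graph_of_inj[OF inj disj]]
  show ?thesis .
qed

theorem theorem5p1:
  fixes V :: "'a set" and E :: "'a set set" and n m \<gamma> :: nat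
  assumes "simple_graph V E"
    and "n = card V" and "m = card E" and "\<gamma> = esd_number V E"
  shows "int m \<le> int (n choose 2) - (int n - int \<gamma>) * (int n - int \<gamma> - 1)
    \<and> (int m = int (n choose 2) - (int n - int \<gamma>) * (int n - int \<gamma> - 1)
         \<longleftrightarrow> complete_minus_bipartite V E (n - \<gamma>))"
proof -
  have fin: "finite V" using assms(1) by (simp add: simple_graph_def)
  obtain S where S: "esd_set V E S" "card S = \<gamma>"
    using esd_number_attained[OF fin] assms(4) by metis
  have SV: "S \<subseteq> V" using S(1) by (simp add: esd_set_def)
  have k: "card (V - S) = n - \<gamma>"
    using SV S(2) assms(2) fin by (simp add: card_Diff_subset finite_subset)
  \<comment> \<open>This keeps the natural number \<open>n - \<gamma>\<close> from being
    truncated.\<close>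
  have "\<gamma> \<le> n" using esd_number_le_order[OF fin] assms(2,4) by simp
  then have int_k: "int (n - \<gamma>) = int n - int \<gamma>" by simp
  let ?bound = "int (n choose 2) - (int n - int \<gamma>) * (int n - int \<gamma> - 1)"
  obtain B M where B: "B \<subseteq> V" "(V - S) \<inter> B = {}" "card B = card (V - S)"
    and M: "perfect_matching (V - S \<union> B) (complete_bipartite_edges (V - S) B) M"
    and E: "E \<subseteq> complete_edges V - (complete_bipartite_edges (V - S) B - M)"
    using esd_set_imp_subset_complete_minus_bipartite[OF assms(1) S(1)] .
  let ?H = "complete_edges V - (complete_bipartite_edges (V - S) B - M)"
  have cardH: "int (card ?H) = ?bound"
    using card_complete_minus_bipartite[OF fin Diff_subset B(1,2) k _ M] B(3) k assms(2) int_k by simp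
  have finH: "finite ?H" using finite_complete_edges[OF fin] by simp
  have "int m \<le> ?bound"
    using card_mono[OF finH E] cardH assms(3) by linarith
  moreover have "complete_minus_bipartite V E (n - \<gamma>)" if "int m = ?bound"
  proof -
    have "card E = card ?H" using that cardH assms(3) by linarith
    \<comment> \<open>In the extremal case \<open>E\<close> lies in a finite set of its own size, so
      nothing is missing.\<close>
    then have "E = ?H" by (rule card_subset_eq[OF finH E])
    then show ?thesis
      unfolding complete_minus_bipartite_def using B M k Diff_subset[of V S] by metis
  qed
  \<comment> \<open>The converse is pure counting: the partite sets given here may be unrelated to
    \<open>S\<close>, but every such graph has the same number of edges.\<close>
  moreover have "int m = ?bound" if "complete_minus_bipartite V E (n - \<gamma>)"
    using that card_complete_minus_bipartite[OF fin, where k = "n - \<gamma>"] assms(2,3) int_k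
    unfolding complete_minus_bipartite_def by auto
  ultimately show ?thesis by blast
qed

end
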